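(* Let $(V,d)$ be a bounded closed Hilbert complex, $(V_h,d)$ a Hilbert subcomplex, and $\pi_h$ a bounded cochain projection from $(V,d)$ to $(V_h,d)$. Suppose that for all $k$ $$\|q-\pi_h^kq\|_V<\|q\|_V,\qquad 0\ne q\in\mathfrak H^k.$$ Then the map on cohomology $\mathfrak Z^k/\mathfrak B^k\to\mathfrak Z_h^k/\mathfrak B_h^k$ induced by $\pi_h$ is an isomorphism (for every $k$).
   Context: A bounded closed Hilbert complex $(V,d)$ is a finite sequence of real Hilbert spaces $V^k$ and bounded linear operators $d^k:V^k\to V^{k+1}$ with $d^{k+1}\circ d^k=0$ and with the range of each $d^k$ closed. $\mathfrak Z^k=\ker d^k$, $\mathfrak B^k=d^{k-1}V^{k-1}$, and $\mathfrak H^k=\mathfrak Z^k\cap(\mathfrak B^k)^\perp$ (the harmonic forms). A Hilbert subcomplex $(V_h,d)$ consists of finite-dimensional subspaces $V_h^k\subset V^k$ with $d^kV_h^k\subset V_h^{k+1}$, with the inherited inner product and differential; $\mathfrak Z_h^k=\ker(d^k|_{V_h^k})$, $\mathfrak B_h^k=d^{k-1}V_h^{k-1}$. A bounded cochain projection $\pi_h$ is a collection of bounded linear maps $\pi_h^k:V^k\to V_h^k$ which restrict to the identity on $V_h^k$ and satisfy $d^k\pi_h^k=\pi_h^{k+1}d^k$. *)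

theory Defs
  imports "HOL-Analysis.Analysis"
begin

text \<open>
  All spaces of a complex are complete linear subspaces \<open>V k\<close> of one real inner product space
  \<open>'a\<close>, with the inherited operations and inner product. This is no loss of generality: a sequence
  of Hilbert spaces embeds isometrically into its Hilbert direct sum. Nothing is assumed about the
  position of the subspaces relative to each other. Operators between these spaces are total
  functions whose values off the domain are irrelevant.
\<close>

definition bounded_linear_on ::
    "'a::real_normed_vector set \<Rightarrow> ('a \<Rightarrow> 'b::real_normed_vector) \<Rightarrow> bool" where
  "bounded_linear_on S f \<longleftrightarrow>
     (\<forall>x\<in>S. \<forall>y\<in>S. f (x + y) = f x + f y) \<and>
     (\<forall>c. \<forall>x\<in>S. f (c *\<^sub>R x) = c *\<^sub>R f x) \<and>
     (\<exists>K. \<forall>x\<in>S. norm (f x) \<le> norm x * K)"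

text \<open>
  A finite sequence of spaces is extended by zero spaces in both directions and indexed by the
  integers, so that \<open>d (k - 1)\<close> and \<open>V (k + 1)\<close> make sense at the ends.
\<close>

definition bounded_closed_hilbert_complex ::
    "(int \<Rightarrow> 'a::real_inner set) \<Rightarrow> (int \<Rightarrow> 'a \<Rightarrow> 'a) \<Rightarrow> bool" where
  "bounded_closed_hilbert_complex V d \<longleftrightarrow>
     finite {k. V k \<noteq> {0}} \<and>
     (\<forall>k. subspace (V k) \<and> complete (V k)) \<and>
     (\<forall>k. bounded_linear_on (V k) (d k) \<and> d k ` V k \<subseteq> V (k + 1)) \<and>
     (\<forall>k. \<forall>v\<in>V k. d (k + 1) (d k v) = 0) \<and>
     (\<forall>k. closedin (top_of_set (V (k + 1))) (d k ` V k))"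

definition cocycles :: "(int \<Rightarrow> 'a::real_inner set) \<Rightarrow> (int \<Rightarrow> 'a \<Rightarrow> 'a) \<Rightarrow> int \<Rightarrow> 'a set" where
  "cocycles V d k = {v \<in> V k. d k v = 0}"

definition coboundaries :: "(int \<Rightarrow> 'a::real_inner set) \<Rightarrow> (int \<Rightarrow> 'a \<Rightarrow> 'a) \<Rightarrow> int \<Rightarrow> 'a set" where
  "coboundaries V d k = d (k - 1) ` V (k - 1)"

definition harmonic_forms :: "(int \<Rightarrow> 'a::real_inner set) \<Rightarrow> (int \<Rightarrow> 'a \<Rightarrow> 'a) \<Rightarrow> int \<Rightarrow> 'a set" where
  "harmonic_forms V d k =
     {q \<in> cocycles V d k. \<forall>b\<in>coboundaries V d k. orthogonal q b}"

definition hilbert_subcomplex ::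
    "(int \<Rightarrow> 'a::real_inner set) \<Rightarrow> (int \<Rightarrow> 'a \<Rightarrow> 'a) \<Rightarrow> (int \<Rightarrow> 'a set) \<Rightarrow> bool" where
  "hilbert_subcomplex V d Vh \<longleftrightarrow>
     (\<forall>k. Vh k \<subseteq> V k \<and> subspace (Vh k) \<and> (\<exists>B. finite B \<and> Vh k = span B)) \<and>
     (\<forall>k. d k ` Vh k \<subseteq> Vh (k + 1))"

definition bounded_cochain_projection ::
    "(int \<Rightarrow> 'a::real_inner set) \<Rightarrow> (int \<Rightarrow> 'a \<Rightarrow> 'a) \<Rightarrow> (int \<Rightarrow> 'a set) \<Rightarrow>
     (int \<Rightarrow> 'a \<Rightarrow> 'a) \<Rightarrow> bool" where
  "bounded_cochain_projection V d Vh \<pi> \<longleftrightarrow>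
     (\<forall>k. bounded_linear_on (V k) (\<pi> k) \<and> \<pi> k ` V k \<subseteq> Vh k) \<and>
     (\<forall>k. \<forall>v\<in>Vh k. \<pi> k v = v) \<and>
     (\<forall>k. \<forall>v\<in>V k. d k (\<pi> k v) = \<pi> (k + 1) (d k v))"

text \<open>
  A quotient \<open>Z / B\<close> is the set of cosets \<open>z +o B\<close>. Addition of cosets is the Minkowski sum
  \<open>+\<close> of sets. In the scalar product the summand \<open>B\<close> matters only for the scalar \<open>0\<close>.
\<close>

definition quotient_space :: "'a::real_vector set \<Rightarrow> 'a set \<Rightarrow> 'a set set" where
  "quotient_space Z B = (\<lambda>z. z +o B) ` Z"

definition coset_scale :: "'a::real_vector set \<Rightarrow> real \<Rightarrow> 'a set \<Rightarrow> 'a set" where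
  "coset_scale B c C = (\<lambda>x. c *\<^sub>R x) ` C + B"

definition quotient_isomorphism ::
    "'a::real_vector set \<Rightarrow> 'a set \<Rightarrow> 'a set \<Rightarrow> 'a set \<Rightarrow> ('a set \<Rightarrow> 'a set) \<Rightarrow> bool" where
  "quotient_isomorphism Z B Z' B' F \<longleftrightarrow>
     bij_betw F (quotient_space Z B) (quotient_space Z' B') \<and>
     (\<forall>C\<in>quotient_space Z B. \<forall>D\<in>quotient_space Z B. F (C + D) = F C + F D) \<and>
     (\<forall>c. \<forall>C\<in>quotient_space Z B. F (coset_scale B c C) = coset_scale B' c (F C))"

text \<open>
  The map of quotients induced by \<open>f\<close>, with target modulo \<open>B'\<close>. If \<open>f\<close> is additive and maps
  \<open>B\<close> into \<open>B'\<close>, it sends \<open>z +o B\<close> to \<open>f z +o B'\<close>; see \<open>induced_map_cohomology\<close>.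
\<close>

definition induced_map :: "'a::real_vector set \<Rightarrow> ('a \<Rightarrow> 'a) \<Rightarrow> 'a set \<Rightarrow> 'a set" where
  "induced_map B' f C = f ` C + B'"

lemma coset_add:
  assumes "subspace B"
  shows "(x +o B) + (y +o B) = (x + y) +o B"
proof -
  have "B + B = B"
    using assms unfolding set_plus_def by (force simp: subspace_add subspace_0)
  then show ?thesis by (simp add: set_plus_rearrange)
qed

lemma coset_scale_coset:
  assumes "subspace B"
  shows "coset_scale B c (x +o B) = (c *\<^sub>R x) +o B"
proof (intro equalityI subsetI)
  fix u assume "u \<in> coset_scale B c (x +o B)"
  then obtain a b where "a \<in> B" "b \<in> B" "u = c *\<^sub>R (x + a) + b"
    unfolding coset_scale_def set_plus_def elt_set_plus_def by auto
  then have "u = c *\<^sub>R x + (c *\<^sub>R a + b)" "c *\<^sub>R a + b \<in> B"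
    using assms by (auto simp: algebra_simps subspace_add subspace_scale)
  then show "u \<in> (c *\<^sub>R x) +o B" unfolding elt_set_plus_def by blast
next
  fix u assume "u \<in> (c *\<^sub>R x) +o B"
  then obtain b where b: "b \<in> B" "u = c *\<^sub>R (x + 0) + b" unfolding elt_set_plus_def by auto
  moreover have "x + 0 \<in> x +o B" using subspace_0[OF assms] by (rule set_plus_intro2)
  ultimately show "u \<in> coset_scale B c (x +o B)"
    unfolding coset_scale_def by (metis imageI set_plus_intro)
qed

lemma induced_map_coset:
  assumes add: "\<And>b. b \<in> B \<Longrightarrow> f (z + b) = f z + f b"
    and "f ` B \<subseteq> B'" "0 \<in> B" "f 0 = 0" "subspace B'"
  shows "induced_map B' f (z +o B) = f z +o B'"
proof (intro equalityI subsetI)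
  fix u assume "u \<in> induced_map B' f (z +o B)"
  then obtain a b where "a \<in> B" "b \<in> B'" "u = f (z + a) + b"
    unfolding induced_map_def set_plus_def elt_set_plus_def by auto
  then have "u = f z + (f a + b)" "f a + b \<in> B'"
    using assms by (auto simp: algebra_simps subspace_add image_subset_iff)
  then show "u \<in> f z +o B'" unfolding elt_set_plus_def by blast
next
  fix u assume "u \<in> f z +o B'"
  then obtain b where "b \<in> B'" "u = f (z + 0) + b" unfolding elt_set_plus_def by auto
  moreover have "z + 0 \<in> z +o B" using \<open>0 \<in> B\<close> by (rule set_plus_intro2)
  ultimately show "u \<in> induced_map B' f (z +o B)"
    unfolding induced_map_def by (metis imageI set_plus_intro)
qed

lemma induced_map_cohomology:
  assumes V: "bounded_closed_hilbert_complex V d" and Vh: "hilbert_subcomplex V d Vh"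
    and P: "bounded_cochain_projection V d Vh \<pi>" and z: "z \<in> cocycles V d k"
  shows "induced_map (coboundaries Vh d k) (\<pi> k) (z +o coboundaries V d k)
         = \<pi> k z +o coboundaries Vh d k"
proof (rule induced_map_coset)
  have sV: "subspace (V j)" and dl: "bounded_linear_on (V j) (d j)"
    and dV: "d j ` V j \<subseteq> V (j + 1)" for j
    using V by (auto simp: bounded_closed_hilbert_complex_def)
  have sVh: "subspace (Vh j)" and VhV: "Vh j \<subseteq> V j" for j
    using Vh by (auto simp: hilbert_subcomplex_def)
  have pl: "bounded_linear_on (V j) (\<pi> j)" and pV: "\<pi> j ` V j \<subseteq> Vh j"
    and pd: "\<And>v. v \<in> V j \<Longrightarrow> d j (\<pi> j v) = \<pi> (j + 1) (d j v)" for j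
    using P by (auto simp: bounded_cochain_projection_def)
  have zero: "f 0 = 0" if "bounded_linear_on (V j) f" for f :: "'a \<Rightarrow> 'a" and j
  proof -
    have "f (0 *\<^sub>R 0) = 0 *\<^sub>R f 0"
      using that subspace_0[OF sV[of j]] unfolding bounded_linear_on_def by blast
    then show ?thesis by simp
  qed
  have BV: "coboundaries V d k \<subseteq> V k"
    using dV[of "k - 1"] by (simp add: coboundaries_def)
  show "\<pi> k (z + b) = \<pi> k z + \<pi> k b" if "b \<in> coboundaries V d k" for b
    using pl[of k] z BV that unfolding bounded_linear_on_def cocycles_def by blast
  show "\<pi> k ` coboundaries V d k \<subseteq> coboundaries Vh d k"
    using pd[of _ "k - 1"] pV[of "k - 1"] by (force simp: coboundaries_def)
  show "0 \<in> coboundaries V d k"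
    using zero[OF dl[of "k - 1"]] subspace_0[OF sV[of "k - 1"]]
    by (force simp: coboundaries_def)
  show "\<pi> k 0 = 0" using zero[OF pl] .
  show "subspace (coboundaries Vh d k)"
  proof (rule subspaceI)
    show "0 \<in> coboundaries Vh d k"
      using zero[OF dl[of "k - 1"]] subspace_0[OF sVh[of "k - 1"]]
      by (force simp: coboundaries_def)
  next
    fix x y assume "x \<in> coboundaries Vh d k" "y \<in> coboundaries Vh d k"
    then obtain a b where ab: "a \<in> Vh (k - 1)" "b \<in> Vh (k - 1)" "x = d (k - 1) a" "y = d (k - 1) b"
      by (auto simp: coboundaries_def)
    then have "x + y = d (k - 1) (a + b)"
      using dl[of "k - 1"] VhV[of "k - 1"] unfolding bounded_linear_on_def by (metis subsetD)
    then show "x + y \<in> coboundaries Vh d k"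
      using ab subspace_add[OF sVh] by (auto simp: coboundaries_def)
  next
    fix c x assume "x \<in> coboundaries Vh d k"
    then obtain a where a: "a \<in> Vh (k - 1)" "x = d (k - 1) a"
      by (auto simp: coboundaries_def)
    then have "c *\<^sub>R x = d (k - 1) (c *\<^sub>R a)"
      using dl[of "k - 1"] VhV[of "k - 1"] unfolding bounded_linear_on_def by (metis subsetD)
    then show "c *\<^sub>R x \<in> coboundaries Vh d k"
      using a subspace_scale[OF sVh] by (auto simp: coboundaries_def)
  qed
qed

end

theory Submission
  imports Defs
begin

text \<open>
  The induced map is surjective because \<open>\<pi>\<close> is the identity on the subcomplex. For injectivity, split
  a cocycle \<open>z\<close> with \<open>\<pi> z\<close> a discrete coboundary as \<open>z = b + q\<close>, where \<open>b\<close> is the orthogonal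
  projection of \<open>z\<close> on the coboundaries and \<open>q\<close> is harmonic. Then \<open>\<pi> q = \<pi> z - \<pi> b\<close> is a coboundary,
  hence orthogonal to \<open>q\<close>, so the norm of \<open>q - \<pi> q\<close> is at least that of \<open>q\<close>, which forces \<open>q = 0\<close>.
\<close>

text \<open>The midpoint of two terms lies in \<open>S\<close>, so it is no closer to
  \<open>z\<close> than \<open>\<delta>\<close> permits. By the parallelogram identity, two nearly
  optimal terms are therefore close to each other.\<close>

lemma Cauchy_minimizing_sequence:
  fixes z :: "'a::real_inner"
  assumes S: "subspace S" and y: "\<And>n. y n \<in> S"
    and lower: "\<And>w. w \<in> S \<Longrightarrow> \<delta> \<le> (norm (z - w))\<^sup>2"
    and upper: "\<And>n. (norm (z - y n))\<^sup>2 < \<delta> + inverse (real (Suc n))"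
  shows "Cauchy y"
proof (rule CauchyI)
  fix e :: real assume "0 < e"
  \<comment> \<open>For \<open>m\<close>, \<open>n\<close> at least \<open>N\<close>, the identity
    below bounds the squared distance by four times \<open>inverse (real (Suc N))\<close>; the
    quarter makes this less than the square of \<open>e\<close>.\<close>
  then obtain N where N: "inverse (real (Suc N)) < e\<^sup>2 / 4"
    using reals_Archimedean[of "e\<^sup>2 / 4"] by auto
  have "norm (y m - y n) < e" if "m \<ge> N" "n \<ge> N" for m n
  proof -
    have "(1/2) *\<^sub>R (y m + y n) \<in> S"
      using y by (intro subspace_scale subspace_add S)
    then have mid: "\<delta> \<le> (norm (z - (1/2) *\<^sub>R (y m + y n)))\<^sup>2"
      by (rule lower)
    \<comment> \<open>This is the parallelogram law for \<open>z - y m\<close> and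
      \<open>z - y n\<close>, whose sum is twice \<open>z\<close> minus the midpoint.\<close>
    have parallelogram: "(norm (y m - y n))\<^sup>2 = 2 * (norm (z - y m))\<^sup>2 + 2 * (norm (z - y n))\<^sup>2
        - 4 * (norm (z - (1/2) *\<^sub>R (y m + y n)))\<^sup>2"
      by (simp add: power2_norm_eq_inner algebra_simps inner_commute)
    have "inverse (real (Suc m)) \<le> inverse (real (Suc N))"
      "inverse (real (Suc n)) \<le> inverse (real (Suc N))"
      using that by (auto intro!: le_imp_inverse_le)
    then have "(norm (y m - y n))\<^sup>2 < e\<^sup>2"
      using parallelogram mid upper[of m] upper[of n] N by linarith
    then show ?thesis
      using \<open>0 < e\<close> by (simp add: power_less_imp_less_base)
  qed
  then show "\<exists>M. \<forall>m\<ge>M. \<forall>n\<ge>M. norm (y m - y n) < e"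
    by blast
qed

text \<open>A sequence in \<open>S\<close> whose squared distances to \<open>z\<close> approach
  their infimum is Cauchy. Completeness is required of \<open>S\<close> alone, since the ambient
  inner product space need not be complete.\<close>

lemma nearest_point_complete_subspace:
  fixes z :: "'a::real_inner"
  assumes S: "subspace S" and "complete S"
  obtains b where "b \<in> S" "\<And>w. w \<in> S \<Longrightarrow> (norm (z - b))\<^sup>2 \<le> (norm (z - w))\<^sup>2"
proof -
  let ?D = "(\<lambda>w. (norm (z - w))\<^sup>2) ` S"
  define \<delta> where "\<delta> = Inf ?D"
  have "?D \<noteq> {}" using subspace_0[OF S] by blast
  have bdd: "bdd_below ?D" by (rule bdd_belowI2[where m = 0]) simp
  have lower: "\<delta> \<le> (norm (z - w))\<^sup>2" if "w \<in> S" for w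
    unfolding \<delta>_def using that bdd by (intro cInf_lower) auto
  have "\<exists>w\<in>S. (norm (z - w))\<^sup>2 < \<delta> + inverse (real (Suc n))" for n
    using cInf_lessD[OF \<open>?D \<noteq> {}\<close>, of "\<delta> + inverse (real (Suc n))"]
    by (auto simp: \<delta>_def)
  then obtain y where y: "\<And>n. y n \<in> S"
    and upper: "\<And>n. (norm (z - y n))\<^sup>2 < \<delta> + inverse (real (Suc n))"
    by metis
  have "Cauchy y"
    using S y lower upper by (rule Cauchy_minimizing_sequence)
  then obtain b where b: "b \<in> S" "y \<longlonglongrightarrow> b"
    using \<open>complete S\<close> y unfolding complete_def by blast
  \<comment> \<open>Continuity of the norm carries the upper bounds over to the limit, which
    therefore attains the infimum.\<close>
  have "(\<lambda>n. (norm (z - y n))\<^sup>2) \<longlonglongrightarrow> (norm (z - b))\<^sup>2"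
    by (intro tendsto_intros b)
  moreover have "(\<lambda>n. \<delta> + inverse (real (Suc n))) \<longlonglongrightarrow> \<delta> + 0"
    by (intro tendsto_intros LIMSEQ_inverse_real_of_nat)
  ultimately have "(norm (z - b))\<^sup>2 \<le> \<delta> + 0"
    by (rule LIMSEQ_le) (use upper less_imp_le in blast)
  then have "(norm (z - b))\<^sup>2 \<le> (norm (z - w))\<^sup>2" if "w \<in> S" for w
    using lower[OF that] by linarith
  with b(1) show thesis by (rule that)
qed

text \<open>At a nearest point \<open>b\<close>, moving within \<open>S\<close> along
  \<open>w\<close> cannot shorten \<open>z - b\<close>, so this vector has no component along
  \<open>w\<close>.\<close>

lemma orthogonal_projection_complete_subspace:
  fixes z :: "'a::real_inner"
  assumes S: "subspace S" and "complete S"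
  obtains b where "b \<in> S" "\<And>w. w \<in> S \<Longrightarrow> orthogonal (z - b) w"
proof -
  obtain b where b: "b \<in> S" and min: "\<And>w. w \<in> S \<Longrightarrow> (norm (z - b))\<^sup>2 \<le> (norm (z - w))\<^sup>2"
    using nearest_point_complete_subspace[OF assms] by blast
  have "inner (z - b) w = 0" if "w \<in> S" for w
  proof (cases "w = 0")
    case False
    define q where "q = z - b"
    \<comment> \<open>This \<open>t\<close> minimizes the norm of \<open>q - t *\<^sub>R w\<close>:
      it is the coefficient of the projection of \<open>q\<close> on the line through
      \<open>w\<close>.\<close>
    define t where "t = inner q w / inner w w"
    have w0: "inner w w > 0" using False by simp
    have "b + t *\<^sub>R w \<in> S" using b that S by (simp add: subspace_add subspace_scale)
    from min[OF this] have "(norm q)\<^sup>2 \<le> (norm (q - t *\<^sub>R w))\<^sup>2"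
      by (simp add: q_def algebra_simps)
    \<comment> \<open>The last term is bracketed so that \<open>t * inner w w\<close> can next be
      replaced by \<open>inner q w\<close>, which cancels half of the linear term.\<close>
    also have "\<dots> = (norm q)\<^sup>2 - 2 * t * inner q w + t * (t * inner w w)"
      by (simp add: power2_norm_eq_inner algebra_simps inner_commute)
    also have "t * inner w w = inner q w"
      using w0 by (simp add: t_def)
    finally have "t * inner q w \<le> 0" by simp
    then have "(inner q w)\<^sup>2 / inner w w \<le> 0"
      by (simp add: t_def power2_eq_square)
    then show ?thesis
      using w0 by (simp add: divide_le_0_iff q_def)
  qed simp
  then show thesis
    using that b by (simp add: orthogonal_def)
qed

lemma coset_eq_iff:
  fixes B :: "'a::real_vector set"
  assumes B: "subspace B"
  shows "x +o B = y +o B \<longleftrightarrow> x - y \<in> B"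
proof
  assume "x +o B = y +o B"
  moreover have "x + 0 \<in> x +o B" using subspace_0[OF B] by (rule set_plus_intro2)
  ultimately show "x - y \<in> B" by (auto simp: set_minus_plus)
next
  assume *: "x - y \<in> B"
  have "u - x \<in> B \<longleftrightarrow> u - y \<in> B" for u
    using subspace_add[OF B _ *, of "u - x"] subspace_diff[OF B _ *, of "u - y"] by auto
  then show "x +o B = y +o B"
    by (auto simp flip: set_minus_plus)
qed

lemma bounded_linear_on_add:
  "\<lbrakk>bounded_linear_on S f; x \<in> S; y \<in> S\<rbrakk> \<Longrightarrow> f (x + y) = f x + f y"
  by (simp add: bounded_linear_on_def)

lemma bounded_linear_on_scale:
  "\<lbrakk>bounded_linear_on S f; x \<in> S\<rbrakk> \<Longrightarrow> f (c *\<^sub>R x) = c *\<^sub>R f x"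
  by (simp add: bounded_linear_on_def)

lemma bounded_linear_on_diff:
  assumes "bounded_linear_on S f" "subspace S" "x \<in> S" "y \<in> S"
  shows "f (x - y) = f x - f y"
  using assms bounded_linear_on_add[of S f x "(-1) *\<^sub>R y"] bounded_linear_on_scale[of S f y "-1"]
  by (simp add: subspace_neg)

lemma bounded_linear_on_zero:
  assumes "bounded_linear_on S f" "subspace S"
  shows "f 0 = 0"
  using bounded_linear_on_diff[OF assms, of 0 0] subspace_0[OF assms(2)] by simp

lemma bounded_linear_on_subset:
  "\<lbrakk>bounded_linear_on S f; T \<subseteq> S\<rbrakk> \<Longrightarrow> bounded_linear_on T f"
  unfolding bounded_linear_on_def by blast

lemma subspace_image_bounded_linear_on:
  assumes f: "bounded_linear_on S f" and S: "subspace S"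
  shows "subspace (f ` S)"
  unfolding subspace_def
proof (intro conjI ballI allI)
  show "0 \<in> f ` S"
    using bounded_linear_on_zero[OF assms] subspace_0[OF S] by force
  show "x + y \<in> f ` S" if "x \<in> f ` S" "y \<in> f ` S" for x y
    using that subspace_add[OF S] by (force simp flip: bounded_linear_on_add[OF f])
  show "c *\<^sub>R x \<in> f ` S" if "x \<in> f ` S" for c x
    using that subspace_scale[OF S] by (force simp flip: bounded_linear_on_scale[OF f])
qed

lemma subspace_kernel_bounded_linear_on:
  assumes "bounded_linear_on S f" "subspace S"
  shows "subspace {x \<in> S. f x = 0}"
  using assms
  by (auto simp: subspace_def bounded_linear_on_zero bounded_linear_on_add bounded_linear_on_scale)

text \<open>Everything reduces to representatives, since the induced map sends \<open>z +o B\<close>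
  to \<open>f z +o B'\<close>. By linearity, injectivity is a condition on the kernel only, and
  surjectivity needs preimages only modulo \<open>B'\<close>.\<close>

lemma quotient_isomorphism_induced_map:
  assumes Z: "subspace Z" and B: "subspace B" and B': "subspace B'"
    and f: "bounded_linear_on Z f" and "B \<subseteq> Z" and fB: "f ` B \<subseteq> B'" and fZ: "f ` Z \<subseteq> Z'"
    and inj: "\<And>z. z \<in> Z \<Longrightarrow> f z \<in> B' \<Longrightarrow> z \<in> B"
    and surj: "\<And>z'. z' \<in> Z' \<Longrightarrow> \<exists>z\<in>Z. f z - z' \<in> B'"
  shows "quotient_isomorphism Z B Z' B' (induced_map B' f)"
proof -
  let ?F = "induced_map B' f"
  have F: "?F (z +o B) = f z +o B'" if "z \<in> Z" for z
    using that \<open>B \<subseteq> Z\<close>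
    by (intro induced_map_coset fB subspace_0[OF B] bounded_linear_on_zero[OF f Z] B')
      (auto simp: bounded_linear_on_add[OF f])
  have "inj_on ?F (quotient_space Z B)"
  proof (rule inj_onI)
    fix C D
    assume "C \<in> quotient_space Z B" "D \<in> quotient_space Z B" and eq: "?F C = ?F D"
    then obtain x y where xy: "x \<in> Z" "y \<in> Z" "C = x +o B" "D = y +o B"
      by (auto simp: quotient_space_def)
    with eq have "f (x - y) \<in> B'"
      by (simp add: F coset_eq_iff[OF B'] bounded_linear_on_diff[OF f Z])
    then show "C = D"
      using xy inj subspace_diff[OF Z] by (simp add: coset_eq_iff[OF B])
  qed
  moreover have "?F ` quotient_space Z B = quotient_space Z' B'"
  proof
    show "?F ` quotient_space Z B \<subseteq> quotient_space Z' B'"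
      using fZ by (auto simp: quotient_space_def F)
    show "quotient_space Z' B' \<subseteq> ?F ` quotient_space Z B"
    proof
      fix C assume "C \<in> quotient_space Z' B'"
      then obtain z' where z': "z' \<in> Z'" "C = z' +o B'" by (auto simp: quotient_space_def)
      then obtain z where z: "z \<in> Z" "f z - z' \<in> B'" using surj by blast
      then have "?F (z +o B) = C" by (simp add: F z' coset_eq_iff[OF B'])
      then show "C \<in> ?F ` quotient_space Z B" using z by (auto simp: quotient_space_def)
    qed
  qed
  ultimately show ?thesis
    unfolding quotient_isomorphism_def bij_betw_def
    by (auto simp: quotient_space_def coset_add[OF B] coset_add[OF B'] coset_scale_coset[OF B]
        coset_scale_coset[OF B'] F subspace_add[OF Z] subspace_scale[OF Z]
        bounded_linear_on_add[OF f] bounded_linear_on_scale[OF f])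
qed

theorem theorem3p4:
  fixes V Vh :: "int \<Rightarrow> 'a::real_inner set"
    and d \<pi> :: "int \<Rightarrow> 'a \<Rightarrow> 'a"
  assumes "bounded_closed_hilbert_complex V d"
    and "hilbert_subcomplex V d Vh"
    and "bounded_cochain_projection V d Vh \<pi>"
    and "\<forall>k. \<forall>q\<in>harmonic_forms V d k. q \<noteq> 0 \<longrightarrow> norm (q - \<pi> k q) < norm q"
  shows "\<forall>k. quotient_isomorphism
               (cocycles V d k) (coboundaries V d k)
               (cocycles Vh d k) (coboundaries Vh d k)
               (induced_map (coboundaries Vh d k) (\<pi> k))"
proof
  fix k
  let ?Z = "cocycles V d k" and ?B = "coboundaries V d k"
    and ?Zh = "cocycles Vh d k" and ?Bh = "coboundaries Vh d k"
  have V: "subspace (V j)" and d: "bounded_linear_on (V j) (d j)"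
    and complete: "complete (V j)" and dV: "d j ` V j \<subseteq> V (j + 1)"
    and dd: "\<And>v. v \<in> V j \<Longrightarrow> d (j + 1) (d j v) = 0"
    and closed: "closedin (top_of_set (V (j + 1))) (d j ` V j)" for j
    using assms(1) by (auto simp: bounded_closed_hilbert_complex_def)
  have Vh: "subspace (Vh j)" and VhV: "Vh j \<subseteq> V j" for j
    using assms(2) by (auto simp: hilbert_subcomplex_def)
  have \<pi>: "bounded_linear_on (V j) (\<pi> j)" and \<pi>V: "\<pi> j ` V j \<subseteq> Vh j"
    and \<pi>_id: "\<And>v. v \<in> Vh j \<Longrightarrow> \<pi> j v = v"
    and \<pi>d: "\<And>v. v \<in> V j \<Longrightarrow> d j (\<pi> j v) = \<pi> (j + 1) (d j v)" for j
    using assms(3) by (auto simp: bounded_cochain_projection_def)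
  have ZV: "?Z \<subseteq> V k" and ZhZ: "?Zh \<subseteq> ?Z" and BhB: "?Bh \<subseteq> ?B"
    using VhV by (auto simp: cocycles_def coboundaries_def)
  have BZ: "?B \<subseteq> ?Z"
    using dV[of "k - 1"] dd[of _ "k - 1"] by (auto simp: cocycles_def coboundaries_def)
  have Z: "subspace ?Z"
    unfolding cocycles_def using d V by (rule subspace_kernel_bounded_linear_on)
  have B: "subspace ?B"
    unfolding coboundaries_def using d V by (rule subspace_image_bounded_linear_on)
  have Bh: "subspace ?Bh"
    unfolding coboundaries_def
    using bounded_linear_on_subset[OF d VhV] Vh by (rule subspace_image_bounded_linear_on)
  \<comment> \<open>The closed range of \<open>d (k - 1)\<close> enters here: a relatively closed
    subset of the complete space \<open>V k\<close> is complete, so projecting on \<open>?B\<close>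
    is possible.\<close>
  have completeB: "complete ?B"
  proof -
    obtain T where "closed T" "?B = V k \<inter> T"
      using closed[of "k - 1"] by (auto simp: coboundaries_def closedin_closed)
    then show ?thesis
      using complete_Int_closed complete by metis
  qed
  \<comment> \<open>The cochain property one degree lower turns \<open>\<pi> k (d (k - 1) v)\<close>
    into \<open>d (k - 1)\<close> of an element of \<open>Vh (k - 1)\<close>.\<close>
  have \<pi>B: "\<pi> k ` ?B \<subseteq> ?Bh"
    using \<pi>d[of _ "k - 1"] \<pi>V[of "k - 1"] by (force simp: coboundaries_def)
  have \<pi>Z: "\<pi> k ` ?Z \<subseteq> ?Zh"
    using \<pi>d[of _ k] \<pi>V[of k] bounded_linear_on_zero[OF \<pi> V] by (auto simp: cocycles_def)
  have inj: "z \<in> ?B" if z: "z \<in> ?Z" and \<pi>z: "\<pi> k z \<in> ?Bh" for z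
  proof -
    obtain b where b: "b \<in> ?B" and orth: "\<And>w. w \<in> ?B \<Longrightarrow> orthogonal (z - b) w"
      using orthogonal_projection_complete_subspace[OF B completeB] by blast
    define q where "q = z - b"
    have "q \<in> harmonic_forms V d k"
      using z b BZ subspace_diff[OF Z] orth by (auto simp: harmonic_forms_def q_def)
    moreover have "norm q \<le> norm (q - \<pi> k q)"
    proof -
      have "\<pi> k q = \<pi> k z - \<pi> k b"
        unfolding q_def using z b BZ ZV by (intro bounded_linear_on_diff[OF \<pi> V]) auto
      \<comment> \<open>Both terms of the difference lie in \<open>?Bh\<close>, and
        \<open>?Bh\<close> is contained in \<open>?B\<close>, to which \<open>q\<close> is
        orthogonal.\<close>
      then have "\<pi> k q \<in> ?B"
        using \<pi>z b \<pi>B BhB subspace_diff[OF Bh] by auto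
      then have "orthogonal q (- \<pi> k q)"
        using orth by (simp add: q_def orthogonal_def)
      from norm_add_Pythagorean[OF this]
      have "(norm q)\<^sup>2 \<le> (norm (q - \<pi> k q))\<^sup>2" by simp
      then show ?thesis by (rule power2_le_imp_le) simp
    qed
    ultimately have "q = 0"
      using assms(4) by force
    then show ?thesis using b by (simp add: q_def)
  qed
  \<comment> \<open>The witness is \<open>z'\<close> itself: it is fixed by \<open>\<pi> k\<close>,
    so the difference is zero.\<close>
  have surj: "\<exists>z\<in>?Z. \<pi> k z - z' \<in> ?Bh" if "z' \<in> ?Zh" for z'
    using that ZhZ \<pi>_id subspace_0[OF Bh] by (intro bexI[of _ z']) (auto simp: cocycles_def)
  show "quotient_isomorphism ?Z ?B ?Zh ?Bh (induced_map ?Bh (\<pi> k))"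
    using Z B Bh bounded_linear_on_subset[OF \<pi> ZV] BZ \<pi>B \<pi>Z inj surj
    by (rule quotient_isomorphism_induced_map)
qed

end
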